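(* Let $0<\alpha\le1$ and $0<\lambda<\mu$. The Adomian series components $\tilde p_k^\alpha(n,t)$, $n,k\ge0$, $t\ge0$, of the state probabilities of the linear fractional birth-death process are given by $$\tilde p_k^\alpha(n,t)=\begin{cases}0,& n=k=0\ \text{or}\ n-k\ge2,\\[1mm] (-1)^k(\mu-\lambda)^k\displaystyle\sum_{l=0}^\infty\Big(\frac{\lambda}{\mu}\Big)^{l}\big(l^k-(l+1)^k\big)\frac{t^{k\alpha}}{\Gamma(k\alpha+1)},& n=0,\ k\ge1,\\[2mm] (-1)^k\Big(\dfrac{\lambda}{\mu}\Big)^{n-1}\dfrac{(\mu-\lambda)^{k+2}}{\mu^2}\displaystyle\sum_{l=0}^\infty\Big(\frac{\lambda}{\mu}\Big)^l\binom{n+l}{l}\sum_{r=0}^{n-1}(-1)^r\binom{n-1}{r}(r+l+1)^k\frac{t^{k\alpha}}{\Gamma(k\alpha+1)},& n\ge1,\ n-k\le1.\end{cases}$$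
   Context: The linear fractional birth-death process has birth rates $\lambda_n=n\lambda$ and death rates $\mu_n=n\mu$, $n\ge0$, and starts from one individual. With $I_t^\alpha g(t)=\frac{1}{\Gamma(\alpha)}\int_0^t (t-s)^{\alpha-1}g(s)\,\mathrm{d}s$ (Riemann–Liouville fractional integral), the Adomian series components of its state probabilities are defined recursively by $\tilde p_0^\alpha(1,t)=1$, $\tilde p_0^\alpha(n,t)=0$ for $n\ne1$, and for $k\ge1$, $n\ge0$, $$\tilde p_k^\alpha(n,t)=I_t^\alpha\big(-n(\lambda+\mu)\tilde p_{k-1}^\alpha(n,t)+(n-1)\lambda\,\tilde p_{k-1}^\alpha(n-1,t)+(n+1)\mu\,\tilde p_{k-1}^\alpha(n+1,t)\big),$$ with $\tilde p_k^\alpha(-1,t)=0$. *)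

theory Defs
  imports "HOL-Analysis.Analysis"
begin

definition RL_integral :: "real \<Rightarrow> (real \<Rightarrow> real) \<Rightarrow> real \<Rightarrow> real" where
  "RL_integral \<alpha> g t = 1 / Gamma \<alpha> * (LBINT s:{0..t}. (t - s) powr (\<alpha> - 1) * g s)"

text \<open>
  \<open>adomian \<alpha> lam mu k n t\<close> is the \<open>k\<close>-th Adomian component of the probability of state \<open>n\<close> at
  time \<open>t\<close>. The state is a natural number, so the convention that the component for the
  state \<open>-1\<close> vanishes becomes the case \<open>n = 0\<close> of the birth term.
\<close>

primrec adomian :: "real \<Rightarrow> real \<Rightarrow> real \<Rightarrow> nat \<Rightarrow> nat \<Rightarrow> real \<Rightarrow> real" where
  "adomian \<alpha> lam mu 0 = (\<lambda>n t. if n = 1 then 1 else 0)"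
| "adomian \<alpha> lam mu (Suc k) = (\<lambda>n. RL_integral \<alpha> (\<lambda>s.
     - real n * (lam + mu) * adomian \<alpha> lam mu k n s
     + (if n = 0 then 0 else real (n - 1) * lam * adomian \<alpha> lam mu k (n - 1) s)
     + real (n + 1) * mu * adomian \<alpha> lam mu k (n + 1) s))"

end

theory Submission
  imports Defs "HOL-Computational_Algebra.Formal_Power_Series"
begin

text \<open>
  Every component is a power of time with a constant factor. Since the fractional integral of
  \<open>s powr b / Gamma (b + 1)\<close> is \<open>t powr (b + \<alpha>) / Gamma (b + \<alpha> + 1)\<close>, the \<open>k\<close>-th component is
  \<open>c k n * (t powr \<alpha>) ^ k / Gamma (k * \<alpha> + 1)\<close>, where the numbers \<open>c k n\<close> satisfy the recursion
  of the forward equation (lemma \<open>adomian_eq_coeff\<close>). They do not depend on \<open>\<alpha>\<close>, so they are the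
  derivatives of order \<open>k\<close> at time \<open>0\<close> of the state probabilities of the classical process.

  For the classical process, put \<open>q = lam / mu\<close> and \<open>x = exp (- (mu - lam) * t)\<close>. The probabilities
  are then rational functions of \<open>x\<close>:
  \<open>(1 - x) / (1 - q x)\<close> for \<open>n = 0\<close> and
  \<open>(1 - q)^2 q^(n-1) x (1 - x)^(n-1) / (1 - q x)^(n+1)\<close> for \<open>n \<ge> 1\<close>. Differentiation in \<open>t\<close> becomes
  the operator \<open>- (mu - lam) x d/dx\<close>, which multiplies the coefficient of \<open>x^m\<close> by
  \<open>- (mu - lam) * m\<close>. Hence \<open>c k n\<close> equals \<open>(- (mu - lam)) ^ k\<close> times the \<open>k\<close>-th moment
  \<open>\<Sum>m. a m * m ^ k\<close> of the coefficients \<open>a m\<close> of the \<open>n\<close>-th function.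

  The proof uses these functions only as formal power series. The forward equation is an identity
  between the series (lemma \<open>state_fps_forward\<close>); reading off coefficients and taking moments turns
  it into the recursion of the \<open>c k n\<close>. Expanding \<open>(1 - x)^(n-1)\<close> by the binomial theorem and
  \<open>1 / (1 - q x)^(n+1)\<close> as a negative binomial series writes the moments as the double sums of the
  statement. All series converge because \<open>q < 1\<close>.
\<close>

unbundle fps_syntax and no vec_syntax

section \<open>Fractional integrals of powers\<close>

text \<open>
  The substitution \<open>s = t * x\<close> reduces the integral to Euler's Beta integral, and the Gamma
  factors of \<open>Beta (b + 1) a\<close> cancel the normalizations.
\<close>

lemma RL_integral_powr:
  assumes "0 < a" "0 \<le> b" "0 < t"
  shows "RL_integral a (\<lambda>s. s powr b / Gamma (b+1)) t = t powr (b+a) / Gamma (b+a+1)"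
proof -
  let ?f = "\<lambda>s. (t - s) powr (a - 1) * s powr b"
  have "((\<lambda>x. x powr b * (1-x) powr (a-1)) has_integral Beta (b+1) a) {0..1}"
    using has_integral_Beta_real[of "b+1" a] assms by simp
  then have "((\<lambda>x. (x/t) powr b * (1-x/t) powr (a-1)) has_integral t * Beta (b+1) a) {0..t}"
    using has_integral_stretch_real[of "\<lambda>x. x powr b * (1-x) powr (a-1)" "Beta (b+1) a" 0 1 "1/t"] assms
    by (simp add: mult.commute image_mult_atLeastAtMost_if')
  then have "((\<lambda>x. t powr (b+a-1) * ((x/t) powr b * (1-x/t) powr (a-1))) has_integral t powr (b+a-1) * (t * Beta (b+1) a)) {0..t}"
    by (rule has_integral_mult_right)
  moreover have "t powr (b+a-1) * ((x/t) powr b * (1-x/t) powr (a-1)) = ?f x" if "x \<in> {0..t}" for x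
  proof -
    have "1 - x/t = (t-x)/t" using assms by (simp add: field_simps)
    moreover have "t powr (b+a-1) = t powr b * t powr (a-1)" by (simp flip: powr_add add: algebra_simps)
    ultimately show ?thesis using that assms by (simp add: powr_divide)
  qed
  moreover have "t powr (b+a-1) * (t * Beta (b+1) a) = t powr (b+a) * Beta (b+1) a"
    using assms by (simp add: powr_diff)
  ultimately have I: "(?f has_integral t powr (b+a) * Beta (b+1) a) {0..t}"
    by (metis (no_types, lifting) has_integral_cong)
  \<comment> \<open>The integrand is nonnegative, so its gauge integral is also its Lebesgue integral.\<close>
  then have "?f absolutely_integrable_on {0..t}"
    by (intro nonnegative_absolutely_integrable_1) (auto simp: has_integral_integrable)
  then have "set_integrable lborel {0..t} ?f"
    unfolding set_integrable_def by (subst (asm) integrable_completion) auto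
  then have "(LBINT s:{0..t}. ?f s) = t powr (b+a) * Beta (b+1) a"
    using set_borel_integral_eq_integral(2) I by (metis integral_unique)
  moreover have "RL_integral a (\<lambda>s. s powr b / Gamma (b+1)) t = (LBINT s:{0..t}. ?f s) / (Gamma a * Gamma (b+1))"
    using set_integral_divide_zero[of lborel "{0..t}" ?f "Gamma (b+1)"]
    by (simp add: RL_integral_def)
  moreover have "Gamma a \<noteq> 0" "Gamma (b+1) \<noteq> 0" using Gamma_real_pos[of a] Gamma_real_pos[of "b+1"] assms by (auto simp del: Gamma_real_pos)
  ultimately show ?thesis by (simp add: Beta_def add_ac)
qed

lemma RL_integral_cmult: "RL_integral a (\<lambda>s. c * g s) t = c * RL_integral a g t"
  using set_integral_mult_right[of lborel "{0..t}" c "\<lambda>s. (t - s) powr (a - 1) * g s"]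
  by (simp add: RL_integral_def mult.left_commute)

text \<open>
  One step of the recursion in time. The powers are written as \<open>(s powr \<alpha>) ^ k\<close>, which differs from
  \<open>s powr (k * \<alpha>)\<close> at \<open>s = 0\<close> when \<open>k = 0\<close>, since \<open>0 powr 0 = 0\<close>; a single point does not change
  the integral.
\<close>

lemma RL_integral_power:
  assumes "0 < \<alpha>" "0 \<le> t"
  shows "RL_integral \<alpha> (\<lambda>s. (s powr \<alpha>) ^ k / Gamma (real k * \<alpha> + 1)) t
     = (t powr \<alpha>) ^ Suc k / Gamma (real (Suc k) * \<alpha> + 1)"
proof (cases "t = 0")
  case True
  have "(LBINT s:{0..0}. g s) = 0" for g :: "real \<Rightarrow> real"
    unfolding set_lebesgue_integral_def
  proof (intro integral_eq_zero_AE eventually_mono[OF AE_lborel_singleton[of 0]])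
    show "indicat_real {0..0} s *\<^sub>R g s = 0" if "s \<noteq> 0" for s
      using that by (simp add: indicator_def)
  qed
  with True show ?thesis by (simp add: RL_integral_def)
next
  case False
  have pw: "(s powr \<alpha>) ^ k = s powr (real k * \<alpha>)" if "s \<noteq> 0" for s k
    using that by (simp add: powr_power mult.commute)
  have "RL_integral \<alpha> (\<lambda>s. (s powr \<alpha>) ^ k / Gamma (real k * \<alpha> + 1)) t
     = RL_integral \<alpha> (\<lambda>s. s powr (real k * \<alpha>) / Gamma (real k * \<alpha> + 1)) t"
    unfolding RL_integral_def set_lebesgue_integral_def
  proof (rule arg_cong2[where f = "(*)"], rule refl, rule integral_cong_AE)
    show "AE s in lborel. indicat_real {0..t} s *\<^sub>R ((t - s) powr (\<alpha> - 1) * ((s powr \<alpha>) ^ k / Gamma (real k * \<alpha> + 1))) =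
      indicat_real {0..t} s *\<^sub>R ((t - s) powr (\<alpha> - 1) * (s powr (real k * \<alpha>) / Gamma (real k * \<alpha> + 1)))"
      by (rule eventually_mono[OF AE_lborel_singleton[of 0]]) (simp only: pw not_False_eq_True)
  qed simp_all
  also have "\<dots> = t powr (real k * \<alpha> + \<alpha>) / Gamma (real k * \<alpha> + \<alpha> + 1)"
    using assms False by (intro RL_integral_powr) auto
  also have "real k * \<alpha> + \<alpha> = real (Suc k) * \<alpha>" by (simp add: algebra_simps)
  finally show ?thesis unfolding pw[OF False] .
qed

section \<open>Separation of the time dependence\<close>

text \<open>
  For \<open>\<alpha> = 1\<close> these are the derivatives of order \<open>k\<close> at time \<open>0\<close> of the state probabilities.
\<close>

primrec adomian_coeff :: "real \<Rightarrow> real \<Rightarrow> nat \<Rightarrow> nat \<Rightarrow> real" where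
  "adomian_coeff lam mu 0 = (\<lambda>n. if n = 1 then 1 else 0)"
| "adomian_coeff lam mu (Suc k) = (\<lambda>n.
     - real n * (lam + mu) * adomian_coeff lam mu k n
     + (if n = 0 then 0 else real (n - 1) * lam * adomian_coeff lam mu k (n - 1))
     + real (n + 1) * mu * adomian_coeff lam mu k (n + 1))"

lemma adomian_eq_coeff:
  assumes "0 < \<alpha>" "0 \<le> t"
  shows "adomian \<alpha> lam mu k n t = adomian_coeff lam mu k n * ((t powr \<alpha>) ^ k / Gamma (real k * \<alpha> + 1))"
  using assms(2)
proof (induction k arbitrary: n t)
  case 0
  then show ?case by simp
next
  case (Suc k)
  define f where "f = (\<lambda>s. (s powr \<alpha>) ^ k / Gamma (real k * \<alpha> + 1))"
  have IH: "adomian \<alpha> lam mu k n s = adomian_coeff lam mu k n * f s" if "0 \<le> s" for n s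
    using Suc.IH[OF that] by (simp add: f_def)
  have "adomian \<alpha> lam mu (Suc k) n t = RL_integral \<alpha> (\<lambda>s. adomian_coeff lam mu (Suc k) n * f s) t"
    unfolding adomian.simps RL_integral_def
    by (intro arg_cong2[where f = "(*)"] refl set_lebesgue_integral_cong)
       (auto simp: IH algebra_simps)
  also have "\<dots> = adomian_coeff lam mu (Suc k) n * ((t powr \<alpha>) ^ Suc k / Gamma (real (Suc k) * \<alpha> + 1))"
    unfolding RL_integral_cmult f_def RL_integral_power[OF assms(1) Suc.prems] ..
  finally show ?case .
qed

text \<open>
  A birth raises the state by one, so from the initial state \<open>1\<close> no state above \<open>k + 1\<close> is reached
  in \<open>k\<close> steps; state \<open>0\<close> has initial probability \<open>0\<close>.
\<close>

lemma adomian_coeff_eq_0: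
  "n = 0 \<and> k = 0 \<or> k + 2 \<le> n \<Longrightarrow> adomian_coeff lam mu k n = 0"
  by (induction k arbitrary: n) auto

section \<open>The forward equation in generating functions\<close>

definition geom_fps :: "real \<Rightarrow> real fps" where
  "geom_fps q = inverse (1 - fps_const q * fps_X)"

lemma geom_fps_mult: "geom_fps q * (1 - fps_const q * fps_X) = 1"
  unfolding geom_fps_def by (rule inverse_mult_eq_1) simp

lemma geom_fps_power_nth: "(geom_fps q ^ Suc n) $ l = real ((n + l) choose l) * q ^ l"
  unfolding geom_fps_def fps_inverse_power[symmetric]
  by (subst one_minus_const_fps_X_neg_power') auto

lemma fps_deriv_geom_fps: "fps_deriv (geom_fps q) = fps_const q * (geom_fps q)^2"
proof -
  let ?R = "geom_fps q"
  have "fps_deriv (?R * (1 - fps_const q * fps_X)) = 0"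
    by (simp only: geom_fps_mult fps_deriv_1)
  then have "fps_deriv ?R * (1 - fps_const q * fps_X) = ?R * fps_const q"
    by (simp add: algebra_simps flip: fps_const_neg)
  then show ?thesis using geom_fps_mult[of q] by algebra
qed

text \<open>
  The state probabilities of the classical process with \<open>q = lam / mu\<close>, expanded in powers of
  \<open>exp (- (mu - lam) * t)\<close>.
\<close>

definition state_fps :: "real \<Rightarrow> nat \<Rightarrow> real fps" where
  "state_fps q n = (if n = 0 then (1 - fps_X) * geom_fps q
     else fps_const ((1 - q)^2 * q^(n-1)) * (fps_X * (1 - fps_X)^(n-1) * geom_fps q ^ Suc n))"

text \<open>
  The polynomial identity behind the forward equation for the states \<open>n = j + 2\<close>, with \<open>R\<close> for
  \<open>1 / (1 - u x)\<close>, \<open>y\<close> for \<open>(1 - x) ^ j\<close> and \<open>d\<close> for \<open>j\<close>. Up to the common factor \<open>x y R^(j+2)\<close> its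
  terms contain \<open>1\<close>, \<open>R\<close> and \<open>R^2\<close>. With \<open>D = 1 - u x\<close> the equations \<open>1 = R^2 D^2\<close> and \<open>R = R^2 D\<close>
  make all terms multiples of \<open>R^2\<close>, and then the cofactors agree as polynomials.
\<close>

lemma forward_identity:
  fixes u x R y d :: "'a::comm_ring_1"
  assumes "R * (1 - u * x) = 1"
  shows "- (1 - u) * (x * (u * ((1-x) * y * R^(j+3) - (d+1) * x * y * R^(j+3)
            + (d+3) * u * x * (1-x) * y * R^(j+4))))
    = - (d+2) * (1+u) * (u * (x * (1-x) * y * R^(j+3))) + (d+1) * u * (x * y * R^(j+2))
      + (d+3) * (u^2 * (x * (1-x)^2 * y * R^(j+4)))"
proof -
  define D where "D = 1 - u * x"
  have D: "R * D = 1" using assms by (simp add: D_def)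
  have R1: "R = R^2 * D" and R0: "1 = R^2 * D^2"
    using D by (simp_all add: power2_eq_square mult_ac) (metis D mult.assoc mult.commute mult.right_neutral)+
  have "- (1 - u) * (u * (((1-x) * D - (d+1) * x * D
            + (d+3) * u * x * (1-x))))
    = - (d+2) * (1+u) * (u * ((1-x) * D)) + (d+1) * u * D^2
      + (d+3) * (u^2 * ((1-x)^2))"
    by (simp add: D_def algebra_simps power2_eq_square)
  then have "R^2 * (- (1 - u) * (u * (((1-x) * D - (d+1) * x * D
            + (d+3) * u * x * (1-x))))) = R^2 * (- (d+2) * (1+u) * (u * ((1-x) * D)) + (d+1) * u * D^2
      + (d+3) * (u^2 * ((1-x)^2)))" by simp
  then have "- (1 - u) * (u * ((1-x) * (R^2*D) - (d+1) * x * (R^2*D)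
            + (d+3) * u * x * (1-x) * R^2))
    = - (d+2) * (1+u) * (u * ((1-x) * (R^2*D))) + (d+1) * u * (R^2*D^2)
      + (d+3) * (u^2 * ((1-x)^2 * R^2))"
    by (simp add: algebra_simps)
  then have "- (1 - u) * (u * ((1-x) * R - (d+1) * x * R
            + (d+3) * u * x * (1-x) * R^2))
    = - (d+2) * (1+u) * (u * ((1-x) * R)) + (d+1) * u
      + (d+3) * (u^2 * ((1-x)^2 * R^2))" (is "?a = ?b")
    by (simp flip: R1 R0)
  then have "x * y * R^(j+2) * ?a = x * y * R^(j+2) * ?b" by simp
  then show ?thesis by (simp add: algebra_simps power_add power2_eq_square eval_nat_numeral)
qed

lemma state_fps_Suc:
  "state_fps q (Suc n) = fps_const ((1 - q)^2) * fps_const q ^ n * (fps_X * (1 - fps_X)^n * geom_fps q ^ (n + 2))"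
  by (simp add: state_fps_def fps_const_power)

text \<open>
  The Kolmogorov forward equation, divided by \<open>mu\<close>: since \<open>(mu - lam) / mu = 1 - q\<close>, the time
  derivative becomes \<open>- (1 - q)\<close> times \<open>fps_XD\<close>, that is, \<open>x d/dx\<close>. The states \<open>0\<close> and \<open>1\<close> are
  separate because \<open>(1 - x)^(n-2)\<close> is a common factor of the terms only for \<open>n \<ge> 2\<close>.
\<close>

lemma state_fps_forward:
  "- (1 - fps_const q) * fps_XD (state_fps q n) =
     - (of_nat n * (1 + fps_const q)) * state_fps q n
     + (if n = 0 then 0 else of_nat (n - 1) * fps_const q * state_fps q (n - 1))
     + of_nat (n + 1) * state_fps q (n + 1)"
proof -
  define v x R K where "v = fps_const q" and "x = (fps_X :: real fps)" and "R = geom_fps q" and "K = fps_const ((1 - q)^2)"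
  have K: "K = (1 - v)^2" unfolding K_def v_def by (simp flip: fps_const_power fps_const_sub)
  have R: "R * (1 - v * x) = 1" using geom_fps_mult[of q] by (simp add: v_def x_def R_def)
  have P0: "state_fps q 0 = (1 - x) * R" by (simp add: state_fps_def x_def R_def)
  have P: "state_fps q (Suc n) = K * v ^ n * (x * (1 - x)^n * R ^ (n + 2))" for n
    by (simp add: state_fps_Suc K_def v_def x_def R_def)
  have D [simp]: "fps_deriv x = 1" "fps_deriv R = v * R^2" "fps_deriv K = 0" "fps_deriv v = 0"
    by (simp_all add: x_def R_def v_def K_def fps_deriv_geom_fps)
  have u: "fps_const q = v" by (simp add: v_def)
  consider "n = 0" | "n = 1" | j where "n = j + 2" by (metis One_nat_def add_2_eq_Suc' not0_implies_Suc)
  then show ?thesis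
  proof cases
    case 1
    have "R = R^2 * (1 - v * x)" using R by (simp add: power2_eq_square mult.assoc)
    then have *: "(1 - x) * (v * R^2) - R = - (1 - v) * R^2" by (simp add: algebra_simps)
    have "fps_XD (state_fps q 0) = x * ((1 - x) * (v * R^2) - R)"
      by (simp add: P0 fps_XD_def x_def[symmetric])
    moreover have "state_fps q 1 = (1 - v)^2 * (x * R^2)"
      using P[of 0] by (simp add: K power2_eq_square)
    moreover have "- (1 - v) * (x * (- (1 - v) * R^2)) = (1 - v)^2 * (x * R^2)"
      by (simp add: power2_eq_square algebra_simps)
    ultimately have "- (1 - v) * fps_XD (state_fps q 0) = state_fps q 1"
      unfolding * by simp
    then show ?thesis using 1 u by simp
  next
    case 2
    have R2: "R^2 = R^3 - v * x * R^3"
    proof -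
      have "R^2 = R^3 * (1 - v * x)" using R by (simp add: power3_eq_cube power2_eq_square mult.assoc)
      then show ?thesis by (simp add: algebra_simps)
    qed
    have id: "- (1 - v) * (R^2 + 2 * v * x * R^3) = - (1 + v) * R^2 + 2 * v * (1 - x) * R^3"
      unfolding R2 by (simp add: algebra_simps)
    have D1: "fps_XD (state_fps q 1) = K * x * (R^2 + 2 * v * x * R^3)"
      using P[of 0] by (simp add: fps_XD_def x_def[symmetric] power2_eq_square power3_eq_cube algebra_simps)
    have s: "state_fps q 1 = K * x * R^2" "state_fps q 2 = K * x * (v * (1 - x) * R^3)"
      using P[of 0] P[of 1] by (simp_all add: numeral_2_eq_2 numeral_3_eq_3 mult_ac)
    have "- (1 - v) * fps_XD (state_fps q 1) = K * x * (- (1 - v) * (R^2 + 2 * v * x * R^3))"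
      unfolding D1 by (simp only: mult_ac)
    also have "\<dots> = - (1 + v) * state_fps q 1 + 2 * state_fps q 2"
      unfolding id s by (simp add: algebra_simps)
    finally have "- (1 - v) * fps_XD (state_fps q 1) = - (1 + v) * state_fps q 1 + 2 * state_fps q 2" .
    then show ?thesis using 2 u by (simp add: numeral_2_eq_2)
  next
    case (3 j)
    define y where "y = (1 - x) ^ j"
    define d where "d = (of_nat j :: real fps)"
    have P1: "state_fps q (j + 1) = K * v^j * (x * y * R^(j+2))"
      using P[of j] by (simp add: y_def)
    have P2: "state_fps q (j + 2) = K * v^j * (v * (x * (1 - x) * y * R^(j+3)))"
      using P[of "j + 1"] by (simp add: y_def mult_ac numeral_3_eq_3)
    have P3: "state_fps q (j + 3) = K * v^j * (v^2 * (x * (1 - x)^2 * y * R^(j+4)))"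
      using P[of "j + 2"] by (simp add: y_def mult_ac eval_nat_numeral)
    have "fps_deriv ((1 - x) * y) = - (d + 1) * y"
      using fps_deriv_power'[of "1 - x" "Suc j"] by (simp add: y_def d_def)
    moreover have "fps_deriv (R^(j+3)) = (d + 3) * v * R^(j+4)"
      using fps_deriv_power'[of R "j + 3"] by (simp add: d_def mult_ac power_add power2_eq_square power3_eq_cube power4_eq_xxxx numeral_3_eq_3)
    moreover have "fps_deriv (x * ((1 - x) * y)) = (1 - x) * y + x * fps_deriv ((1 - x) * y)"
      unfolding fps_deriv_mult[of x] by simp
    ultimately have F: "fps_deriv (x * ((1 - x) * y) * R^(j+3)) =
        (1-x) * y * R^(j+3) - (d+1) * x * y * R^(j+3) + (d+3) * v * x * (1-x) * y * R^(j+4)"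
      unfolding fps_deriv_mult[of "x * ((1 - x) * y)"] by (simp only:) (simp add: algebra_simps)
    have "state_fps q (j+2) = (K * v^j * v) * (x * ((1 - x) * y) * R^(j+3))"
      unfolding P2 by (simp only: mult_ac)
    moreover have "fps_deriv (K * v^j * v) = 0" by (simp add: fps_deriv_power')
    ultimately have "fps_deriv (state_fps q (j+2)) = (K * v^j * v) * fps_deriv (x * ((1 - x) * y) * R^(j+3))"
      by (simp only: fps_deriv_mult[of "K * v^j * v"]) simp
    then have D: "fps_XD (state_fps q (j+2)) = K * v^j * (x * (v * ((1-x) * y * R^(j+3) - (d+1) * x * y * R^(j+3)
            + (d+3) * v * x * (1-x) * y * R^(j+4))))"
      unfolding F fps_XD_def x_def[symmetric] o_def by (simp only: mult_ac)
    have "- (1 - v) * fps_XD (state_fps q (j+2)) = K * v^j * (- (1 - v) * (x * (v * ((1-x) * y * R^(j+3) - (d+1) * x * y * R^(j+3)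
            + (d+3) * v * x * (1-x) * y * R^(j+4)))))"
      unfolding D by (simp only: mult_ac)
    also have "\<dots> = - (d+2) * (1+v) * state_fps q (j+2) + (d+1) * v * state_fps q (j+1) + (d+3) * state_fps q (j+3)"
      unfolding forward_identity[OF R] P1 P2 P3 by (simp only: distrib_left mult_ac)
    finally have "- (1 - v) * fps_XD (state_fps q (j+2)) = - (d+2) * (1+v) * state_fps q (j+2)
        + (d+1) * v * state_fps q (j+1) + (d+3) * state_fps q (j+3)" .
    moreover have "of_nat (j + 2) = d + 2" "of_nat (j + 1) = d + 1" "of_nat (j + 3) = d + 3"
      by (simp_all add: d_def)
    moreover have "j + 2 - 1 = j + 1" "j + 2 + 1 = j + 3" "j + 2 \<noteq> 0" by simp_all
    ultimately show ?thesis unfolding 3 u by (simp only: if_False mult_minus_left)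
  qed
qed

section \<open>Moments as double sums\<close>

lemma sums_fps_X_power_mult:
  assumes "(\<lambda>l. B $ l * g (l + j)) sums s"
  shows "(\<lambda>m. (fps_X ^ j * B) $ m * g m) sums (s::real)"
proof -
  have "(\<lambda>l. (fps_X ^ j * B) $ (l + j) * g (l + j)) sums s"
    using assms by (simp add: fps_X_power_mult_nth)
  moreover have "(\<Sum>m<j. (fps_X ^ j * B) $ m * g m) = 0"
    by (simp add: fps_X_power_mult_nth)
  ultimately show ?thesis
    using sums_iff_shift[of "\<lambda>m. (fps_X ^ j * B) $ m * g m" j s] by (simp only: add_0_right)
qed

text \<open>
  Multiplying a series by a polynomial shifts and superposes its coefficients. A weighted sum
  over the coefficients of the product is therefore a double sum, in which the inner sum runs over
  the monomials of the polynomial.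
\<close>

lemma sums_polynomial_mult:
  fixes B :: "real fps"
  assumes "\<And>r. r \<in> A \<Longrightarrow> summable (\<lambda>l. B $ l * g (l + e r))"
  shows "summable (\<lambda>l. B $ l * (\<Sum>r\<in>A. d r * g (l + e r)))"
    and "(\<lambda>m. ((\<Sum>r\<in>A. fps_const (d r) * fps_X ^ e r) * B) $ m * g m) sums
           (\<Sum>l. B $ l * (\<Sum>r\<in>A. d r * g (l + e r)))"
proof -
  let ?s = "\<lambda>r. \<Sum>l. B $ l * g (l + e r)"
  have "(\<lambda>l. \<Sum>r\<in>A. d r * (B $ l * g (l + e r))) sums (\<Sum>r\<in>A. d r * ?s r)"
    using assms by (intro sums_sum sums_mult summable_sums)
  then have 1: "(\<lambda>l. B $ l * (\<Sum>r\<in>A. d r * g (l + e r))) sums (\<Sum>r\<in>A. d r * ?s r)"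
    by (simp add: sum_distrib_left mult_ac)
  then show "summable (\<lambda>l. B $ l * (\<Sum>r\<in>A. d r * g (l + e r)))" by (rule sums_summable)
  have "(\<lambda>m. \<Sum>r\<in>A. d r * ((fps_X ^ e r * B) $ m * g m)) sums (\<Sum>r\<in>A. d r * ?s r)"
    using assms by (intro sums_sum sums_mult sums_fps_X_power_mult summable_sums)
  moreover have "((\<Sum>r\<in>A. fps_const (d r) * fps_X ^ e r) * B) $ m * g m =
      (\<Sum>r\<in>A. d r * ((fps_X ^ e r * B) $ m * g m))" for m
    by (simp only: sum_distrib_right fps_sum_nth mult.assoc fps_mult_left_const_nth)
  ultimately show "(\<lambda>m. ((\<Sum>r\<in>A. fps_const (d r) * fps_X ^ e r) * B) $ m * g m) sums
           (\<Sum>l. B $ l * (\<Sum>r\<in>A. d r * g (l + e r)))"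
    unfolding sums_unique[OF 1, symmetric] by (simp only:)
qed

text \<open>
  Differentiating a power series preserves its disc of convergence; \<open>k\<close> derivatives of the
  geometric series, each followed by a multiplication by \<open>x\<close>, give the case \<open>c = 0\<close>. The general case
  is a shift of the index by \<open>c\<close>.
\<close>

lemma summable_power_times_geometric:
  fixes q :: real
  assumes "0 < q" "q < 1"
  shows "summable (\<lambda>l. real (l + c) ^ k * q ^ l)"
proof -
  have "summable (\<lambda>n. real n ^ k * x ^ n)" if "norm x < 1" for x :: real
    using that
  proof (induction k arbitrary: x)
    case 0
    then show ?case by simp
  next
    case (Suc k)
    from termdiff_converges[OF Suc.prems Suc.IH]
    have "summable (\<lambda>n. real (Suc n) ^ Suc k * x ^ n)" by (simp add: diffs_def)
    then have "summable (\<lambda>n. x * (real (Suc n) ^ Suc k * x ^ n))" by (rule summable_mult)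
    then have "summable (\<lambda>n. real (Suc n) ^ Suc k * x ^ Suc n)" by (simp add: mult_ac)
    then show ?case by (subst (asm) summable_Suc_iff)
  qed
  then have "summable (\<lambda>l. real (l + c) ^ k * q ^ (l + c))"
    using assms by (subst summable_iff_shift[where f="\<lambda>n. real n ^ k * q ^ n"]) simp
  then have "summable (\<lambda>l. (real (l + c) ^ k * q ^ (l + c)) / q ^ c)" by (rule summable_divide)
  then show ?thesis using assms by (simp add: power_add)
qed

text \<open>
  The coefficients of \<open>1 / (1 - q x)^(n+1)\<close> are \<open>q ^ l\<close> times a polynomial in \<open>l\<close>
  of degree \<open>n\<close>, so a bound by a power of \<open>l + (n + j)\<close> reduces this to the previous lemma.
\<close>

lemma summable_geom_fps_power:
  fixes q :: real
  assumes "0 < q" "q < 1"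
  shows "summable (\<lambda>l. (geom_fps q ^ Suc n) $ l * real (l + j) ^ k)"
proof (rule summable_comparison_test')
  show "summable (\<lambda>l. real (l + (n + j)) ^ (n + k) * q ^ l)"
    using assms by (rule summable_power_times_geometric)
next
  fix l :: nat
  have "(n + l) choose l = (n + l) choose n" using binomial_symmetric[of l "n + l"] by simp
  also have "\<dots> \<le> (n + l) ^ n" by (rule binomial_le_pow) simp
  also have "\<dots> \<le> (l + (n + j)) ^ n" by (rule power_mono) auto
  finally have "real ((n + l) choose l) \<le> real (l + (n + j)) ^ n"
    by (metis of_nat_le_iff of_nat_power)
  then have "real ((n + l) choose l) * real (l + j) ^ k \<le> real (l + (n + j)) ^ n * real (l + (n + j)) ^ k"
    by (intro mult_mono power_mono) auto
  then have "real ((n + l) choose l) * real (l + j) ^ k * q ^ l \<le> real (l + (n + j)) ^ (n + k) * q ^ l"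
    using assms by (intro mult_right_mono) (auto simp: power_add)
  then show "norm ((geom_fps q ^ Suc n) $ l * real (l + j) ^ k) \<le> real (l + (n + j)) ^ (n + k) * q ^ l"
    using assms unfolding geom_fps_power_nth by (simp add: abs_mult mult_ac)
qed

lemma state_fps_0_moment:
  fixes q :: real
  assumes "0 < q" "q < 1"
  shows "summable (\<lambda>l. q ^ l * (real l ^ k - (real l + 1) ^ k))"
    and "(\<lambda>m. state_fps q 0 $ m * real m ^ k) sums (\<Sum>l. q ^ l * (real l ^ k - (real l + 1) ^ k))"
proof -
  let ?d = "\<lambda>r. (-1) ^ r :: real"
  have B: "geom_fps q $ l = q ^ l" for l using geom_fps_power_nth[of q 0 l] by simp
  have "summable (\<lambda>l. geom_fps q $ l * real (l + r) ^ k)" for r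
    using summable_geom_fps_power[OF assms, of 0] by simp
  note * = sums_polynomial_mult[where A = "{0, 1}" and e = "\<lambda>r. r" and d = ?d and g = "\<lambda>m. real m ^ k", OF this]
  have P: "(\<Sum>r\<in>{0,1}. fps_const (?d r) * fps_X ^ r) = 1 - fps_X" by simp
  have g: "(\<Sum>r\<in>{0,1}. ?d r * real (l + r) ^ k) = real l ^ k - (real l + 1) ^ k" for l
    by (simp add: add_ac)
  show "summable (\<lambda>l. q ^ l * (real l ^ k - (real l + 1) ^ k))"
    using *(1) unfolding B g .
  have "state_fps q 0 = (1 - fps_X) * geom_fps q" by (simp add: state_fps_def)
  then show "(\<lambda>m. state_fps q 0 $ m * real m ^ k) sums (\<Sum>l. q ^ l * (real l ^ k - (real l + 1) ^ k))"
    using *(2) unfolding P B g by (simp only:)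
qed

lemma state_fps_pos_moment:
  fixes q :: real and n k :: nat
  assumes "0 < q" "q < 1" "1 \<le> n"
  defines "S \<equiv> (\<lambda>l. q ^ l * real ((n + l) choose l)
        * (\<Sum>r=0..n - 1. (-1) ^ r * real ((n - 1) choose r) * (real r + real l + 1) ^ k))"
  shows "summable S"
    and "(\<lambda>m. state_fps q n $ m * real m ^ k) sums ((1 - q)^2 * q ^ (n - 1) * (\<Sum>l. S l))"
proof -
  let ?d = "\<lambda>r. (-1) ^ r * real ((n - 1) choose r)"
  note * = sums_polynomial_mult[where A = "{0..n-1}" and e = "\<lambda>r. r + 1" and d = ?d and g = "\<lambda>m. real m ^ k",
     OF summable_geom_fps_power[OF assms(1,2), of n]]
  have "(1 - fps_X :: real fps) ^ (n - 1) = (\<Sum>r=0..n-1. fps_const (?d r) * fps_X ^ r)"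
  proof -
    have "(1 - fps_X :: real fps) ^ (n - 1) = (- fps_X + 1) ^ (n - 1)" by simp
    also have "\<dots> = (\<Sum>r=0..n-1. of_nat ((n - 1) choose r) * (- fps_X) ^ r)"
      by (subst binomial_ring) (simp add: atLeast0AtMost)
    also have "\<dots> = (\<Sum>r=0..n-1. fps_const (?d r) * fps_X ^ r)"
    proof (intro sum.cong refl)
      fix r
      have "fps_const (?d r) = (-1) ^ r * of_nat ((n - 1) choose r)"
        by (simp only: fps_const_mult[symmetric] fps_const_power[symmetric] fps_const_neg[symmetric]
            fps_of_nat fps_const_1_eq_1)
      then show "of_nat ((n - 1) choose r) * (- fps_X) ^ r = fps_const (?d r) * fps_X ^ r"
        by (simp only: power_minus[of fps_X] mult_ac)
    qed
    finally show ?thesis .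
  qed
  then have 1: "(\<Sum>r=0..n-1. fps_const (?d r) * fps_X ^ (r + 1)) = fps_X * (1 - fps_X) ^ (n - 1)"
    by (simp only: sum_distrib_left power_add power_one_right mult_ac)
  have S: "(geom_fps q ^ Suc n) $ l * (\<Sum>r=0..n-1. ?d r * real (l + (r + 1)) ^ k) = S l" for l
  proof -
    have "real (l + (r + 1)) = real r + real l + 1" for r by simp
    then show ?thesis unfolding S_def geom_fps_power_nth by (simp only: mult_ac)
  qed
  show "summable S" using *(1) unfolding S .
  have "(\<lambda>m. (fps_X * (1 - fps_X) ^ (n - 1) * geom_fps q ^ Suc n) $ m * real m ^ k) sums (\<Sum>l. S l)"
    using *(2) unfolding S 1 .
  from sums_mult[OF this, of "(1 - q)^2 * q ^ (n - 1)"]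
  have "(\<lambda>m. (fps_const ((1 - q)^2 * q ^ (n - 1)) * (fps_X * (1 - fps_X) ^ (n - 1) * geom_fps q ^ Suc n)) $ m * real m ^ k)
    sums ((1 - q)^2 * q ^ (n - 1) * (\<Sum>l. S l))"
    unfolding fps_mult_left_const_nth by (simp only: mult.assoc)
  moreover have "n \<noteq> 0" using assms(3) by simp
  ultimately
  show "(\<lambda>m. state_fps q n $ m * real m ^ k) sums ((1 - q)^2 * q ^ (n - 1) * (\<Sum>l. S l))"
    unfolding state_fps_def by (simp only: if_False)
qed

section \<open>The coefficients as moments\<close>

definition state_moment :: "real \<Rightarrow> nat \<Rightarrow> nat \<Rightarrow> real" where
  "state_moment q k n = (\<Sum>m. state_fps q n $ m * real m ^ k)"

lemma summable_state_moment:
  assumes "0 < q" "q < 1"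
  shows "summable (\<lambda>m. state_fps q n $ m * real m ^ k)"
  using state_fps_0_moment(2)[OF assms] state_fps_pos_moment(2)[OF assms, of n]
  by (cases "n = 0") (auto simp: sums_iff)

text \<open>
  Multiplying the coefficient of \<open>x^m\<close> in the forward equation by \<open>m ^ k\<close> and summing over \<open>m\<close>
  raises the order of the moment on the left, because \<open>fps_XD\<close> contributes one more factor \<open>m\<close>.
\<close>

lemma state_moment_Suc:
  assumes "0 < q" "q < 1"
  shows "- (1 - q) * state_moment q (Suc k) n =
     - (real n * (1 + q)) * state_moment q k n
     + (if n = 0 then 0 else real (n - 1) * q * state_moment q k (n - 1))
     + real (n + 1) * state_moment q k (n + 1)"
proof -
  \<comment> \<open>The weight \<open>c\<close> vanishes at \<open>n = 0\<close>, so the truncated subtraction in \<open>n - 1\<close> does no harm.\<close>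
  define c :: real where "c = (if n = 0 then 0 else real (n - 1) * q)"
  have eq: "fps_const (- (1 - q)) * fps_XD (state_fps q n) = fps_const (- (real n * (1 + q))) * state_fps q n
      + fps_const c * state_fps q (n - 1) + fps_const (real (n + 1)) * state_fps q (n + 1)"
  proof -
    have 1: "fps_const (- (1 - q)) = - (1 - fps_const q)"
      by (simp only: fps_const_neg[symmetric] fps_const_sub[symmetric] fps_const_1_eq_1)
    have 2: "fps_const (- (real n * (1 + q))) = - (of_nat n * (1 + fps_const q))"
      by (simp only: fps_const_neg[symmetric] fps_const_mult[symmetric] fps_const_add[symmetric] fps_const_1_eq_1 fps_of_nat)
    have 3: "fps_const c * state_fps q (n - 1) = (if n = 0 then 0 else of_nat (n - 1) * fps_const q * state_fps q (n - 1))"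
      by (simp only: c_def fps_const_mult[symmetric] fps_of_nat fps_const_0_eq_0 split: if_split) simp
    show ?thesis unfolding 1 2 3 fps_of_nat by (rule state_fps_forward)
  qed
  have "- (1 - q) * (state_fps q n $ m * real m ^ Suc k) =
      - (real n * (1 + q)) * (state_fps q n $ m * real m ^ k)
      + c * (state_fps q (n - 1) $ m * real m ^ k) + real (n + 1) * (state_fps q (n + 1) $ m * real m ^ k)" for m
  proof -
    have "- (1 - q) * (real m * state_fps q n $ m) = - (real n * (1 + q)) * state_fps q n $ m
      + c * state_fps q (n - 1) $ m + real (n + 1) * state_fps q (n + 1) $ m"
      using arg_cong[OF eq, of "\<lambda>F. F $ m"] by (simp only: fps_add_nth fps_mult_left_const_nth fps_XD_nth)
    from arg_cong[OF this, of "\<lambda>y. y * real m ^ k"] show ?thesis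
      by (simp add: algebra_simps)
  qed
  moreover have sums: "(\<lambda>m. state_fps q n $ m * real m ^ k) sums state_moment q k n" for n k
    unfolding state_moment_def using summable_state_moment[OF assms] by (rule summable_sums)
  ultimately have "(\<lambda>m. - (1 - q) * (state_fps q n $ m * real m ^ Suc k)) sums
     (- (real n * (1 + q)) * state_moment q k n
     + c * state_moment q k (n - 1) + real (n + 1) * state_moment q k (n + 1))"
    by (simp only:) (intro sums_add sums_mult sums)
  moreover have "(\<lambda>m. - (1 - q) * (state_fps q n $ m * real m ^ Suc k)) sums (- (1 - q) * state_moment q (Suc k) n)"
    by (intro sums_mult sums)
  ultimately have "- (1 - q) * state_moment q (Suc k) n = - (real n * (1 + q)) * state_moment q k n
     + c * state_moment q k (n - 1) + real (n + 1) * state_moment q k (n + 1)"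
    using sums_unique2 by blast
  then show ?thesis by (simp add: c_def)
qed

text \<open>
  The moment of order \<open>0\<close> is the value at \<open>x = 1\<close>, that is, at time \<open>0\<close>. For \<open>n \<ge> 2\<close> it vanishes
  because of the factor \<open>(1 - x)^(n-1)\<close>, which here is an alternating sum of binomial coefficients.
\<close>

lemma state_moment_0:
  assumes "0 < q" "q < 1"
  shows "state_moment q 0 n = (if n = 1 then 1 else 0)"
proof -
  consider "n = 0" | "n = 1" | "n \<ge> 2" by linarith
  then show ?thesis
  proof cases
    case 1
    then show ?thesis using sums_unique[OF state_fps_0_moment(2)[OF assms, of 0]] by (simp add: state_moment_def)
  next
    case 2
    have "(\<lambda>l. real (Suc l) * q ^ l) sums (1 / (1 - q)^2)"
      using geometric_deriv_sums[of q] assms by simp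
    then have "(\<Sum>l. q ^ l * real (Suc l)) = 1 / (1 - q)^2" by (simp add: sums_iff mult.commute)
    then show ?thesis using 2 sums_unique[OF state_fps_pos_moment(2)[OF assms, of 1 0]] assms
      by (simp add: state_moment_def)
  next
    case 3
    then have "(\<Sum>r=0..n-1. (-1) ^ r * real ((n - 1) choose r)) = 0"
      using choose_alternating_sum[of "n - 1", where ?'a = real] by (simp add: atLeast0AtMost)
    then show ?thesis using 3 sums_unique[OF state_fps_pos_moment(2)[OF assms, of n 0]]
      by (simp add: state_moment_def)
  qed
qed

lemma adomian_coeff_eq_moment:
  assumes "0 < lam" "lam < mu"
  shows "adomian_coeff lam mu k n = (-1) ^ k * (mu - lam) ^ k * state_moment (lam / mu) k n"
proof (induction k arbitrary: n)
  case 0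
  then show ?case using state_moment_0[of "lam / mu" n] assms by simp
next
  case (Suc k)
  let ?q = "lam / mu" and ?c = "(-1) ^ k * (mu - lam) ^ k"
  have q: "0 < ?q" "?q < 1" using assms by auto
  have "adomian_coeff lam mu (Suc k) n = ?c * mu * (- (real n * (1 + ?q)) * state_moment ?q k n
     + (if n = 0 then 0 else real (n - 1) * ?q * state_moment ?q k (n - 1))
     + real (n + 1) * state_moment ?q k (n + 1))"
    using assms by (simp add: Suc.IH field_simps)
  also have "\<dots> = ?c * (- (mu - lam)) * state_moment ?q (Suc k) n"
    unfolding state_moment_Suc[OF q, symmetric] using assms by (simp add: field_simps)
  finally show ?case by (simp add: algebra_simps)
qed

theorem corollary4p2:
  fixes \<alpha> lam mu t :: real and n k :: nat
  assumes "0 < \<alpha>" and "\<alpha> \<le> 1"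
    and "0 < lam" and "lam < mu"
    and "0 \<le> t"
  shows "((n = 0 \<and> k = 0 \<or> k + 2 \<le> n) \<longrightarrow> adomian \<alpha> lam mu k n t = 0) \<and>
    (n = 0 \<and> 1 \<le> k \<longrightarrow>
      summable (\<lambda>l. (lam / mu) ^ l * (real l ^ k - (real l + 1) ^ k)) \<and>
      adomian \<alpha> lam mu k n t =
        (-1) ^ k * (mu - lam) ^ k
        * (\<Sum>l. (lam / mu) ^ l * (real l ^ k - (real l + 1) ^ k))
        * ((t powr \<alpha>) ^ k / Gamma (real k * \<alpha> + 1))) \<and>
    (1 \<le> n \<and> n \<le> k + 1 \<longrightarrow>
      summable (\<lambda>l. (lam / mu) ^ l * real ((n + l) choose l)
        * (\<Sum>r=0..n - 1. (-1) ^ r * real ((n - 1) choose r) * (real r + real l + 1) ^ k)) \<and>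
      adomian \<alpha> lam mu k n t =
        (-1) ^ k * (lam / mu) ^ (n - 1) * ((mu - lam) ^ (k + 2) / mu\<^sup>2)
        * (\<Sum>l. (lam / mu) ^ l * real ((n + l) choose l)
            * (\<Sum>r=0..n - 1. (-1) ^ r * real ((n - 1) choose r) * (real r + real l + 1) ^ k))
        * ((t powr \<alpha>) ^ k / Gamma (real k * \<alpha> + 1)))"
proof -
  let ?q = "lam / mu" and ?T = "(t powr \<alpha>) ^ k / Gamma (real k * \<alpha> + 1)"
  let ?S = "\<lambda>l. ?q ^ l * real ((n + l) choose l)
        * (\<Sum>r=0..n - 1. (-1) ^ r * real ((n - 1) choose r) * (real r + real l + 1) ^ k)"
  have q: "0 < ?q" "?q < 1" using assms by auto
  note ad = adomian_eq_coeff[OF \<open>0 < \<alpha>\<close> \<open>0 \<le> t\<close>]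
  note coeff = adomian_coeff_eq_moment[OF \<open>0 < lam\<close> \<open>lam < mu\<close>]
  have "adomian \<alpha> lam mu k n t = 0" if "n = 0 \<and> k = 0 \<or> k + 2 \<le> n"
    using that by (simp only: ad adomian_coeff_eq_0 mult_zero_left)
  moreover have "adomian \<alpha> lam mu k n t = (-1) ^ k * (mu - lam) ^ k
        * (\<Sum>l. ?q ^ l * (real l ^ k - (real l + 1) ^ k)) * ?T" if "n = 0"
    unfolding ad coeff state_moment_def that sums_unique[OF state_fps_0_moment(2)[OF q], symmetric] ..
  moreover have "adomian \<alpha> lam mu k n t = (-1) ^ k * ?q ^ (n - 1) * ((mu - lam) ^ (k + 2) / mu\<^sup>2)
        * (\<Sum>l. ?S l) * ?T" if n: "1 \<le> n"
  proof -
    have "(1 - ?q)\<^sup>2 = (mu - lam)\<^sup>2 / mu\<^sup>2" using assms by (simp add: field_simps)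
    then show ?thesis
      unfolding ad coeff state_moment_def sums_unique[OF state_fps_pos_moment(2)[OF q n], symmetric]
      by (simp add: power_add power2_eq_square)
  qed
  ultimately show ?thesis
    using state_fps_0_moment(1)[OF q, of k] state_fps_pos_moment(1)[OF q, of n k] by blast
qed

end
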